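(* Assume $1<|\mathcal X|<|\mathcal Y|$ and $\mathcal W_\kappa(\mathcal Y,\mathcal E)\neq\emptyset$. If $$\sum_{(x,x')\in\mathcal D}|\mathcal S_x|>\left(|\mathcal D|-|\mathcal U|\right)+\left(|\mathcal Y|-|\mathcal X|\right)+\left(|\mathcal E|-|\mathcal R|\right),$$ then $\mathcal W_\kappa(\mathcal Y,\mathcal E)$ does not form an e-family.
   Context: Let $\mathcal Y$ be a finite set and $\mathcal E\subset\mathcal Y^2$ a nonempty edge set such that the digraph $(\mathcal Y,\mathcal E)$ is strongly connected. $\mathcal F(\mathcal Y,\mathcal E)=\mathbb R^{\mathcal E}$ is the space of real functions on $\mathcal E$, identified with real $\mathcal Y\times\mathcal Y$ matrices vanishing outside $\mathcal E$; $\mathcal F^+(\mathcal Y,\mathcal E)$ is the subset of those that are strictly positive on $\mathcal E$; $\mathcal W(\mathcal Y,\mathcal E)\subset\mathcal F^+(\mathcal Y,\mathcal E)$ is the set of row-stochastic ones. Let $\kappa\colon\mathcal Y\to\mathcal X$ be surjective, $\mathcal S_x=\kappa^{-1}(x)$, $\mathcal D=\{(\kappa(y),\kappa(y')):(y,y')\in\mathcal E\}$, and write $F(y,\mathcal S_{x'})=\sum_{y'\in\mathcal S_{x'}}F(y,y')$. $\mathcal W_\kappa(\mathcal Y,\mathcal E)$ is the set of $\kappa$-lumpable $P\in\mathcal W(\mathcal Y,\mathcal E)$, i.e. those with $P(y_1,\mathcal S_{x'})=P(y_2,\mathcal S_{x'})$ for all $(x,x')\in\mathcal D$ and $y_1,y_2\in\mathcal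 S_x$. For $(x,x')\in\mathcal D$ let $\mathcal M_{x,x'}=\{y\in\mathcal S_x:\exists\, y_1'\neq y_2'\in\mathcal S_{x'},\ (y,y_1'),(y,y_2')\in\mathcal E\}$; let $\mathcal M=\{(x,x')\in\mathcal D:\mathcal M_{x,x'}\neq\emptyset\}$, $\mathcal U=\{(x,x')\in\mathcal D:\mathcal M_{x,x'}\neq\mathcal S_x\}$ and $\mathcal R=\bigcup_{(x_0,x_0')\in\mathcal M}\{(y_0,y_0')\in\mathcal M_{x_0,x_0'}\times\mathcal S_{x_0'}:(y_0,y_0')\in\mathcal E\}$. E-families: for $F\in\mathcal F^+(\mathcal Y,\mathcal E)$ with Perron–Frobenius root $\rho_F$ and positive right eigenvector $v_F$, put $\mathfrak s(F)(y,y')=\frac{F(y,y')v_F(y')}{\rho_F v_F(y)}$, so $\mathfrak s(F)\in\mathcal W(\mathcal Y,\mathcal E)$. Let $\mathcal N(\mathcal Y,\mathcal E)$ be the linear space of $N\in\mathcal F(\mathcal Y,\mathcal E)$ of the form $N(y,y')=f(y')-f(y)+c$ with $f\in\mathbb R^{\mathcal Y}$, $c\in\mathbb R$. A set $\mathcal V\subset\mathcal W(\mathcal Y,\mathcal E)$ forms an e-family (of dimension $d\ge 0$) if there are $K\in\mathcal F(\mathcal Y,\mathcal E)$ and $G_1,\dots,G_d\in\mathcal F(\mathcal Y,\mathcal E)$, linearly independent modulo $\mathcal N(\mathcal Y,\mathcal E)$, with $\mathcal V=\{\mathfrak s(\exp(K+\sum_{i=1}^d\theta^iG_i)):\theta\in\mathbb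 R^d\}$, where $\exp$ is applied entrywise on $\mathcal E$. *)

theory Defs
  imports "HOL-Analysis.Analysis"
begin

text \<open>
  The finite state space is a type \<open>'y\<close> of class \<open>finite\<close>, and a function on the edge set
  \<open>E\<close> is the matrix \<open>F :: real^'y^'y\<close> with entry \<open>F $ y $ y'\<close> at \<open>(y, y')\<close> that vanishes
  outside \<open>E\<close>.
\<close>

definition strongly_connected :: "('y \<times> 'y) set \<Rightarrow> bool" where
  "strongly_connected E \<longleftrightarrow> (\<forall>y y'. (y, y') \<in> E\<^sup>*)"

definition edge_funs :: "('y \<times> 'y) set \<Rightarrow> (real^'y^'y::finite) set" where
  "edge_funs E = {F. \<forall>y y'. (y, y') \<notin> E \<longrightarrow> F $ y $ y' = 0}"

definition pos_edge_funs :: "('y \<times> 'y) set \<Rightarrow> (real^'y^'y::finite) set" where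
  "pos_edge_funs E = {F \<in> edge_funs E. \<forall>(y, y') \<in> E. F $ y $ y' > 0}"

definition stoch :: "('y \<times> 'y) set \<Rightarrow> (real^'y^'y::finite) set" where
  "stoch E = {P \<in> pos_edge_funs E. \<forall>y. (\<Sum>y'\<in>UNIV. P $ y $ y') = 1}"


subsection \<open>Lumpability\<close>

definition fibre :: "('y \<Rightarrow> 'x) \<Rightarrow> 'x \<Rightarrow> 'y set" where
  "fibre \<kappa> x = \<kappa> -` {x}"

definition lumped_edges :: "('y \<Rightarrow> 'x) \<Rightarrow> ('y \<times> 'y) set \<Rightarrow> ('x \<times> 'x) set" where
  "lumped_edges \<kappa> E = {(\<kappa> y, \<kappa> y') | y y'. (y, y') \<in> E}"

definition row_sum_on :: "real^'y^'y::finite \<Rightarrow> 'y \<Rightarrow> 'y set \<Rightarrow> real" where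
  "row_sum_on F y S = (\<Sum>y'\<in>S. F $ y $ y')"

definition lumpable :: "('y \<Rightarrow> 'x) \<Rightarrow> ('y \<times> 'y) set \<Rightarrow> (real^'y^'y::finite) set" where
  "lumpable \<kappa> E = {P \<in> stoch E. \<forall>(x, x') \<in> lumped_edges \<kappa> E.
     \<forall>y1 \<in> fibre \<kappa> x. \<forall>y2 \<in> fibre \<kappa> x.
       row_sum_on P y1 (fibre \<kappa> x') = row_sum_on P y2 (fibre \<kappa> x')}"

definition multi_pts :: "('y \<Rightarrow> 'x) \<Rightarrow> ('y \<times> 'y) set \<Rightarrow> 'x \<Rightarrow> 'x \<Rightarrow> 'y set" where
  "multi_pts \<kappa> E x x' = {y \<in> fibre \<kappa> x.
     \<exists>y1 \<in> fibre \<kappa> x'. \<exists>y2 \<in> fibre \<kappa> x'. y1 \<noteq> y2 \<and> (y, y1) \<in> E \<and> (y, y2) \<in> E}"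

definition M_set :: "('y \<Rightarrow> 'x) \<Rightarrow> ('y \<times> 'y) set \<Rightarrow> ('x \<times> 'x) set" where
  "M_set \<kappa> E = {(x, x') \<in> lumped_edges \<kappa> E. multi_pts \<kappa> E x x' \<noteq> {}}"

definition U_set :: "('y \<Rightarrow> 'x) \<Rightarrow> ('y \<times> 'y) set \<Rightarrow> ('x \<times> 'x) set" where
  "U_set \<kappa> E = {(x, x') \<in> lumped_edges \<kappa> E. multi_pts \<kappa> E x x' \<noteq> fibre \<kappa> x}"

definition R_set :: "('y \<Rightarrow> 'x) \<Rightarrow> ('y \<times> 'y) set \<Rightarrow> ('y \<times> 'y) set" where
  "R_set \<kappa> E = (\<Union>(x, x') \<in> M_set \<kappa> E. (multi_pts \<kappa> E x x' \<times> fibre \<kappa> x') \<inter> E)"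


subsection \<open>Stochastic rescaling and e-families\<close>

definition complex_eigenvalues :: "real^'y^'y::finite \<Rightarrow> complex set" where
  "complex_eigenvalues F =
     {\<mu>. \<exists>u :: complex^'y. u \<noteq> 0 \<and> (\<chi> y y'. complex_of_real (F $ y $ y')) *v u = \<mu> *s u}"

text \<open>The Perron--Frobenius root is the spectral radius.\<close>

definition pf_root :: "real^'y^'y::finite \<Rightarrow> real" where
  "pf_root F = Sup (norm ` complex_eigenvalues F)"

text \<open>
  For \<open>F \<in> pos_edge_funs E\<close> with \<open>E\<close> strongly connected and nonempty, a positive right
  eigenvector exists and is unique up to a positive factor, which cancels in
  \<open>stoch_rescale\<close>; hence the choice is harmless.
\<close>

definition pf_vec :: "real^'y^'y::finite \<Rightarrow> real^'y" where
  "pf_vec F = (SOME v. (\<forall>y. v $ y > 0) \<and> F *v v = pf_root F *s v)"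

definition stoch_rescale :: "real^'y^'y::finite \<Rightarrow> real^'y^'y" where
  "stoch_rescale F = (\<chi> y y'. F $ y $ y' * pf_vec F $ y' / (pf_root F * pf_vec F $ y))"

definition exp_on :: "('y \<times> 'y) set \<Rightarrow> real^'y^'y::finite \<Rightarrow> real^'y^'y" where
  "exp_on E H = (\<chi> y y'. if (y, y') \<in> E then exp (H $ y $ y') else 0)"

definition N_space :: "('y \<times> 'y) set \<Rightarrow> (real^'y^'y::finite) set" where
  "N_space E = {N \<in> edge_funs E.
     \<exists>(f :: 'y \<Rightarrow> real) (c :: real). \<forall>(y, y') \<in> E. N $ y $ y' = f y' - f y + c}"

definition indep_mod_N :: "('y \<times> 'y) set \<Rightarrow> nat \<Rightarrow> (nat \<Rightarrow> real^'y^'y::finite) \<Rightarrow> bool" where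
  "indep_mod_N E d G \<longleftrightarrow>
     (\<forall>c :: nat \<Rightarrow> real. (\<Sum>i<d. c i *\<^sub>R G i) \<in> N_space E \<longrightarrow> (\<forall>i<d. c i = 0))"

text \<open>
  The generators are \<open>G 0, \<dots>, G (d - 1)\<close>; a parameter in \<open>d\<close>-dimensional space is a
  sequence \<open>\<theta>\<close> of which only the first \<open>d\<close> terms are used.
\<close>

definition e_family_of_dim ::
  "('y \<times> 'y) set \<Rightarrow> nat \<Rightarrow> (real^'y^'y::finite) set \<Rightarrow> bool" where
  "e_family_of_dim E d V \<longleftrightarrow> V \<subseteq> stoch E \<and>
     (\<exists>K \<in> edge_funs E. \<exists>G. (\<forall>i<d. G i \<in> edge_funs E) \<and> indep_mod_N E d G \<and>
        V = {stoch_rescale (exp_on E (K + (\<Sum>i<d. \<theta> i *\<^sub>R G i))) | \<theta> :: nat \<Rightarrow> real. True})"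

definition e_family :: "('y \<times> 'y) set \<Rightarrow> (real^'y^'y::finite) set \<Rightarrow> bool" where
  "e_family E V \<longleftrightarrow> (\<exists>d. e_family_of_dim E d V)"

end

theory Submission
  imports Defs
begin

text \<open>
  The proof compares dimensions on a logarithmic scale. Call a function on \<open>E\<close> that is positive and
  has constant block sums, but need not be stochastic, \<^emph>\<open>positive lumpable\<close>. Suppose that the lumpable
  kernels form an e-family. Up to terms \<open>f y' - f y + c\<close>, which the stochastic rescaling does not
  see, the logarithms of its members then fill an affine space \<open>K + T\<close>: every lumpable \<open>P\<close> has
  \<open>ln P\<close> in \<open>K + T\<close>, and every point of \<open>K + T\<close> equals \<open>ln P\<close> plus such a term for some lumpable \<open>P\<close>
  (\<open>e_family_imp_log_affine\<close>).

  The space \<open>T\<close> is large. Rescaling a positive lumpable function by the lift of a Perron eigenvector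
  of its lumped matrix makes it stochastic and keeps it lumpable (\<open>lumpable_rescaling_exists\<close>), so
  \<open>K + T\<close> contains the logarithms of all positive lumpable functions. Multiplying a whole block by a
  constant stays among them, so \<open>T\<close> contains every block-constant matrix. Moving mass between two
  edges that leave one point for the same fibre also stays among them; since the curve
  \<open>(ln s, ln (1 - s))\<close> is not contained in a line, \<open>T\<close> contains the unit matrix of every edge in
  \<open>R_set\<close>. A block of \<open>U_set\<close> has an edge outside \<open>R_set\<close>, so that matrices in \<open>T\<close> take
  arbitrary values on \<open>card R_set + card U_set\<close> edges (\<open>tangent_mem\<close>).

  On the other hand \<open>K + T\<close> is covered by the smooth map \<open>(F, f) \<mapsto> ln F + f y' - f y\<close>, where \<open>F\<close> is
  positive lumpable and \<open>f\<close> vanishes at one chosen point of every fibre; the constant \<open>c\<close> and the part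
  of \<open>f\<close> that is constant on fibres are absorbed into \<open>F\<close> (\<open>log_image_attains\<close>). Its domain spans a
  space of dimension at most
  \<open>card E - (\<Sum>(x, x')\<in>D. card (fibre x)) + card D + CARD('y) - CARD('x)\<close> with \<open>D\<close> the lumped edge set
  (\<open>dim_lumpable_space_le\<close>). A smooth map does not raise dimension, so this number is at least
  \<open>card R_set + card U_set\<close> (\<open>log_affine_dimension_bound\<close>). The hypothesis says that it is smaller.
\<close>

section \<open>A positive eigenvector of a strongly connected matrix\<close>

text \<open>
  The part of the Perron--Frobenius theorem that is used: Brouwer's theorem gives a fixed point of the
  normalised action of \<open>Q\<close> on the probability simplex, and strong connectivity carries positivity
  backwards along edges from one coordinate of that point to all of them.
\<close>

lemma positive_eigenvector_exists:
  fixes Q :: "real^'x^'x::finite"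
  assumes nonneg: "\<And>x x'. Q $ x $ x' \<ge> 0"
    and D: "\<And>x x'. (x, x') \<in> D \<Longrightarrow> Q $ x $ x' > 0"
    and "strongly_connected D" and "D \<noteq> {}"
  obtains v :: "real^'x" and r where "\<And>x. v $ x > 0" and "r > 0" and "Q *v v = r *s v"
proof -
  define S :: "(real^'x) set" where "S = {v. (\<forall>x. v $ x \<ge> 0) \<and> (\<Sum>x\<in>UNIV. v $ x) = 1}"
  define m where "m v = (\<Sum>x\<in>UNIV. (Q *v v) $ x)" for v
  have conn: "(x, x') \<in> D\<^sup>*" for x x'
    using \<open>strongly_connected D\<close> by (simp add: strongly_connected_def)
  have in_edge: "\<exists>x. (x, x') \<in> D" for x'
  proof -
    obtain a b where ab: "(a, b) \<in> D" using \<open>D \<noteq> {}\<close> by auto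
    show ?thesis using conn[of b x'] ab by (cases rule: rtranclE) auto
  qed
  have entry: "(Q *v v) $ x = (\<Sum>x'\<in>UNIV. Q $ x $ x' * v $ x')" for v x
    by (simp add: matrix_vector_mult_def)
  have image_pos: "(Q *v v) $ x > 0" if "\<And>x. v $ x \<ge> 0" "(x, x') \<in> D" "v $ x' > 0" for v x x'
    unfolding entry
    by (rule sum_pos2[where i=x']) (use that nonneg D in auto)
  have Qnn: "(Q *v v) $ x \<ge> 0" if "\<And>x. v $ x \<ge> 0" for v x
    unfolding entry using that nonneg by (intro sum_nonneg) auto
  \<comment> \<open>Every column of Q has a positive entry, so no point of the simplex is mapped to 0
    and the normalisation is defined.\<close>
  have m_pos: "m v > 0" if v: "v \<in> S" for v
  proof -
    have nn: "\<And>x. v $ x \<ge> 0" using v by (auto simp: S_def)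
    have "\<exists>x'. v $ x' \<noteq> 0"
    proof (rule ccontr)
      assume "\<not> ?thesis"
      then have "(\<Sum>x\<in>UNIV. v $ x) = 0" by simp
      with v show False by (simp add: S_def)
    qed
    then obtain x' where "v $ x' > 0" using nn by (metis less_eq_real_def)
    moreover obtain x where "(x, x') \<in> D" using in_edge by blast
    ultimately show ?thesis unfolding m_def
      by (intro sum_pos2[where i=x]) (use image_pos nn Qnn in auto)
  qed
  have "compact S"
  proof (rule compact_eq_bounded_closed[THEN iffD2], intro conjI)
    have "norm v \<le> 1" if "v \<in> S" for v
    proof -
      have "norm v \<le> (\<Sum>x\<in>UNIV. \<bar>v $ x\<bar>)" by (rule norm_le_l1_cart)
      also have "\<dots> = 1" using that by (simp add: S_def)
      finally show ?thesis .
    qed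
    then show "bounded S" by (auto simp: bounded_iff)
    have "S = (\<Inter>x. {v. v $ x \<ge> 0}) \<inter> {v. (\<Sum>x\<in>UNIV. v $ x) = 1}" by (auto simp: S_def)
    also have "closed \<dots>"
      by (intro closed_Int closed_INT ballI closed_Collect_le closed_Collect_eq continuous_intros)
    finally show "closed S" .
  qed
  moreover have "convex S"
    by (rule convexI) (auto simp: S_def sum.distrib sum_distrib_left[symmetric])
  moreover have "S \<noteq> {}"
  proof -
    have "(axis undefined 1 :: real^'x) \<in> S" by (simp add: S_def axis_def)
    then show ?thesis by blast
  qed
  moreover have "continuous_on S (\<lambda>v. (1 / m v) *\<^sub>R (Q *v v))"
    unfolding m_def
    by (intro continuous_intros matrix_vector_mult_linear_continuous_on
        continuous_on_component) (use m_pos in \<open>force simp: m_def\<close>)+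
  moreover have "(\<lambda>v. (1 / m v) *\<^sub>R (Q *v v)) \<in> S \<rightarrow> S"
  proof
    fix v assume v: "v \<in> S"
    have "(\<Sum>x\<in>UNIV. ((1 / m v) *\<^sub>R (Q *v v)) $ x) = 1"
      using m_pos[OF v] by (simp add: sum_divide_distrib[symmetric] m_def)
    moreover have "((1 / m v) *\<^sub>R (Q *v v)) $ x \<ge> 0" for x
      using m_pos[OF v] Qnn[of v x] v by (simp add: S_def)
    ultimately show "(1 / m v) *\<^sub>R (Q *v v) \<in> S" by (simp add: S_def)
  qed
  ultimately obtain v where v: "v \<in> S" and fix_v: "(1 / m v) *\<^sub>R (Q *v v) = v"
    by (rule brouwer)
  have eig: "Q *v v = m v *s v"
  proof -
    have "m v *\<^sub>R ((1 / m v) *\<^sub>R (Q *v v)) = Q *v v" using m_pos[OF v] by simp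
    then show ?thesis by (simp add: fix_v scalar_mult_eq_scaleR)
  qed
  have nn: "\<And>x. v $ x \<ge> 0" using v by (auto simp: S_def)
  obtain z where z: "v $ z > 0"
  proof (rule ccontr)
    assume "\<not> thesis"
    then have "\<And>x. v $ x = 0" using nn that by (metis less_eq_real_def)
    then show False using v by (simp add: S_def)
  qed
  have "v $ x > 0" for x
    using conn[of x z]
  proof (induction rule: converse_rtrancl_induct)
    case (step a b)
    then have "(Q *v v) $ a > 0" using image_pos nn by blast
    then show ?case using m_pos[OF v] by (simp add: eig zero_less_mult_iff)
  qed (rule z)
  then show thesis using m_pos[OF v] eig by (rule that)
qed

section \<open>Positive lumpable functions\<close>

text \<open>
  Unlike \<open>lumpable\<close>, this set is cut out of the positive functions by conditions that treat every
  block separately, so one block may be changed without touching the others.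
\<close>

definition positive_lumpable :: "('y \<Rightarrow> 'x) \<Rightarrow> ('y \<times> 'y) set \<Rightarrow> (real^'y^'y::finite) set" where
  "positive_lumpable \<kappa> E = {F \<in> pos_edge_funs E. \<forall>(x, x') \<in> lumped_edges \<kappa> E.
     \<forall>y1 \<in> fibre \<kappa> x. \<forall>y2 \<in> fibre \<kappa> x.
       row_sum_on F y1 (fibre \<kappa> x') = row_sum_on F y2 (fibre \<kappa> x')}"

lemma lumpable_eq: "lumpable \<kappa> E = stoch E \<inter> positive_lumpable \<kappa> E"
  by (auto simp: lumpable_def positive_lumpable_def stoch_def)

lemma positive_lumpableD:
  assumes "F \<in> positive_lumpable \<kappa> E"
  shows "(y, y') \<in> E \<Longrightarrow> F $ y $ y' > 0" and "(y, y') \<notin> E \<Longrightarrow> F $ y $ y' = 0"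
    and "F $ y $ y' \<ge> 0"
proof -
  show *: "F $ y $ y' > 0" if "(y, y') \<in> E"
    using assms that by (auto simp: positive_lumpable_def pos_edge_funs_def)
  show **: "F $ y $ y' = 0" if "(y, y') \<notin> E"
    using assms that by (auto simp: positive_lumpable_def pos_edge_funs_def edge_funs_def)
  show "F $ y $ y' \<ge> 0" using * ** by (cases "(y, y') \<in> E") auto
qed

lemma mem_fibre [simp]: "y \<in> fibre \<kappa> x \<longleftrightarrow> \<kappa> y = x"
  by (simp add: fibre_def)

lemma lumped_edgesI: "(y, y') \<in> E \<Longrightarrow> (\<kappa> y, \<kappa> y') \<in> lumped_edges \<kappa> E"
  by (auto simp: lumped_edges_def)

lemma row_sum_on_fibre_pos:
  assumes "F \<in> positive_lumpable \<kappa> E" and "(y, y') \<in> E"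
  shows "row_sum_on F y (fibre \<kappa> (\<kappa> y')) > 0"
  unfolding row_sum_on_def
  by (rule sum_pos2[where i=y']) (use positive_lumpableD[OF assms(1)] assms(2) in auto)

text \<open>
  For pairs outside the lumped edge set both sides vanish, so the block sums agree for all pairs.
\<close>

lemma row_sum_on_fibre_eq:
  assumes F: "F \<in> positive_lumpable \<kappa> E" and "\<kappa> y1 = \<kappa> y2"
  shows "row_sum_on F y1 (fibre \<kappa> x') = row_sum_on F y2 (fibre \<kappa> x')"
proof (cases "(\<kappa> y1, x') \<in> lumped_edges \<kappa> E")
  case True
  have "\<forall>(x, x') \<in> lumped_edges \<kappa> E. \<forall>y1 \<in> fibre \<kappa> x. \<forall>y2 \<in> fibre \<kappa> x.
      row_sum_on F y1 (fibre \<kappa> x') = row_sum_on F y2 (fibre \<kappa> x')"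
    using F unfolding positive_lumpable_def by blast
  note bspec[OF this True, unfolded prod.case]
  from bspec[OF bspec[OF this, of y1], of y2] show ?thesis using assms(2) by simp
next
  case False
  have "row_sum_on F y (fibre \<kappa> x') = 0" if "\<kappa> y = \<kappa> y1" for y
    unfolding row_sum_on_def
  proof (rule sum.neutral, rule ballI)
    fix z assume "z \<in> fibre \<kappa> x'"
    then have "(y, z) \<notin> E" using False that lumped_edgesI[of y z E \<kappa>] by auto
    then show "F $ y $ z = 0" by (rule positive_lumpableD[OF F])
  qed
  then show ?thesis using assms(2) by simp
qed

text \<open>
  One edge into a fibre makes the block sum positive at its source, hence at every point of the
  source fibre.
\<close>

lemma edge_into_fibre:
  assumes F: "F \<in> positive_lumpable \<kappa> E" and "(\<kappa> y, x') \<in> lumped_edges \<kappa> E"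
  shows "\<exists>y'. \<kappa> y' = x' \<and> (y, y') \<in> E"
proof -
  obtain a b where ab: "(a, b) \<in> E" "\<kappa> a = \<kappa> y" "\<kappa> b = x'"
    using assms(2) by (auto simp: lumped_edges_def)
  have "row_sum_on F y (fibre \<kappa> x') > 0"
    using row_sum_on_fibre_pos[OF F ab(1)] row_sum_on_fibre_eq[OF F ab(2)] ab(3) by simp
  then obtain y' where "y' \<in> fibre \<kappa> x'" "F $ y $ y' \<noteq> 0"
    unfolding row_sum_on_def by (metis less_irrefl sum.neutral)
  moreover from this have "(y, y') \<in> E" using positive_lumpableD(2)[OF F] by blast
  ultimately show ?thesis by auto
qed

lemma strongly_connected_lumped_edges:
  assumes "strongly_connected E" and "surj \<kappa>"
  shows "strongly_connected (lumped_edges \<kappa> E)"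
  unfolding strongly_connected_def
proof (intro allI)
  fix x x'
  obtain y y' where x: "x = \<kappa> y" "x' = \<kappa> y'"
    using surjD[OF \<open>surj \<kappa>\<close>, of x] surjD[OF \<open>surj \<kappa>\<close>, of x'] by blast
  have "(y, y') \<in> E\<^sup>*" using assms(1) by (simp add: strongly_connected_def)
  then have "(\<kappa> y, \<kappa> y') \<in> (lumped_edges \<kappa> E)\<^sup>*"
  proof (induction rule: rtrancl_induct)
    case (step a b)
    then show ?case by (meson lumped_edgesI rtrancl.rtrancl_into_rtrancl)
  qed simp
  with x show "(x, x') \<in> (lumped_edges \<kappa> E)\<^sup>*" by simp
qed

lemma positive_lumpableI:
  assumes "\<And>y y'. (y, y') \<in> E \<Longrightarrow> F $ y $ y' > 0" and "\<And>y y'. (y, y') \<notin> E \<Longrightarrow> F $ y $ y' = 0"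
    and "\<And>y1 y2 x'. \<kappa> y1 = \<kappa> y2 \<Longrightarrow>
      row_sum_on F y1 (fibre \<kappa> x') = row_sum_on F y2 (fibre \<kappa> x')"
  shows "F \<in> positive_lumpable \<kappa> E"
  unfolding positive_lumpable_def pos_edge_funs_def edge_funs_def mem_Collect_eq
proof (intro conjI)
  show "\<forall>(x, x') \<in> lumped_edges \<kappa> E. \<forall>y1 \<in> fibre \<kappa> x. \<forall>y2 \<in> fibre \<kappa> x.
      row_sum_on F y1 (fibre \<kappa> x') = row_sum_on F y2 (fibre \<kappa> x')"
    by (auto intro!: assms(3))
qed (use assms(1,2) in auto)

lemma positive_lumpable_scale_blocks:
  assumes F: "F \<in> positive_lumpable \<kappa> E"
  shows "(\<chi> y y'. exp (g (\<kappa> y) (\<kappa> y')) * F $ y $ y') \<in> positive_lumpable \<kappa> E" (is "?F \<in> _")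
proof (rule positive_lumpableI)
  fix y1 y2 x' assume eq: "\<kappa> y1 = \<kappa> y2"
  have "row_sum_on ?F y (fibre \<kappa> x') = exp (g (\<kappa> y) x') * row_sum_on F y (fibre \<kappa> x')" for y
    by (simp add: row_sum_on_def sum_distrib_left)
  then show "row_sum_on ?F y1 (fibre \<kappa> x') = row_sum_on ?F y2 (fibre \<kappa> x')"
    using row_sum_on_fibre_eq[OF F eq] eq by simp
qed (use positive_lumpableD[OF F] in auto)

text \<open>
  Moving the mass \<open>u\<close> from the edge to \<open>b\<close> to the edge to \<open>a\<close> keeps the block sum, because \<open>a\<close> and
  \<open>b\<close> lie in one fibre.
\<close>

lemma positive_lumpable_shift:
  fixes F :: "real^'y^'y::finite"
  assumes F: "F \<in> positive_lumpable \<kappa> E" and ab: "(y0, a) \<in> E" "(y0, b) \<in> E" "\<kappa> a = \<kappa> b"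
    and u: "- F $ y0 $ a < u" "u < F $ y0 $ b"
  shows "(\<chi> y y'. F $ y $ y' + (if y = y0 \<and> y' = a then u else 0)
      - (if y = y0 \<and> y' = b then u else 0)) \<in> positive_lumpable \<kappa> E" (is "?F \<in> _")
proof (rule positive_lumpableI)
  fix y1 y2 x' assume eq: "\<kappa> y1 = \<kappa> y2"
  have "row_sum_on ?F y (fibre \<kappa> x') = row_sum_on F y (fibre \<kappa> x')" for y
    using ab(3) by (cases "y = y0") (simp_all add: row_sum_on_def sum.distrib sum_subtractf)
  then show "row_sum_on ?F y1 (fibre \<kappa> x') = row_sum_on ?F y2 (fibre \<kappa> x')"
    using row_sum_on_fibre_eq[OF F eq] by simp
next
  fix y y' assume "(y, y') \<in> E"
  then show "?F $ y $ y' > 0" using positive_lumpableD(1)[OF F] u by auto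
next
  fix y y' assume "(y, y') \<notin> E"
  then show "?F $ y $ y' = 0" using positive_lumpableD(2)[OF F] ab by auto
qed

text \<open>
  A positive eigenvector of the lumped matrix, lifted along \<open>\<kappa>\<close>, is a positive right eigenvector of
  \<open>F\<close>. Rescaling by it multiplies each block by a constant, which preserves lumpability.
\<close>

lemma lumpable_rescaling_exists:
  fixes E :: "('y::finite \<times> 'y) set" and \<kappa> :: "'y \<Rightarrow> 'x::finite"
  assumes "E \<noteq> {}" and "strongly_connected E" and "surj \<kappa>"
    and F: "F \<in> positive_lumpable \<kappa> E"
  obtains P g c where "P \<in> lumpable \<kappa> E"
    and "\<And>y y'. (y, y') \<in> E \<Longrightarrow> ln (P $ y $ y') = ln (F $ y $ y') + g y' - g y + c"
proof -
  define Q :: "real^'x^'x" where "Q = (\<chi> x x'. row_sum_on F (inv \<kappa> x) (fibre \<kappa> x'))"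
  have inv: "\<kappa> (inv \<kappa> x) = x" for x using \<open>surj \<kappa>\<close> by (simp add: surj_f_inv_f)
  have Q: "row_sum_on F y (fibre \<kappa> x') = Q $ \<kappa> y $ x'" for y x'
    by (simp add: Q_def) (rule row_sum_on_fibre_eq[OF F], simp add: inv)
  have "Q $ x $ x' \<ge> 0" for x x'
    unfolding Q_def row_sum_on_def
    by (simp add: sum_nonneg positive_lumpableD(3)[OF F])
  moreover have "Q $ x $ x' > 0" if "(x, x') \<in> lumped_edges \<kappa> E" for x x'
    using that row_sum_on_fibre_pos[OF F] Q by (force simp: lumped_edges_def)
  moreover have "lumped_edges \<kappa> E \<noteq> {}"
    using \<open>E \<noteq> {}\<close> by (auto simp: lumped_edges_def)
  ultimately obtain v :: "real^'x" and r where v: "\<And>x. v $ x > 0" and r: "r > 0"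
      and eig: "Q *v v = r *s v"
    using positive_eigenvector_exists[OF _ _ strongly_connected_lumped_edges[OF assms(2,3)]]
    by blast
  define P :: "real^'y^'y" where
    "P = (\<chi> y y'. F $ y $ y' * v $ \<kappa> y' / (r * v $ \<kappa> y))"
  have block: "row_sum_on P y (fibre \<kappa> x') = Q $ \<kappa> y $ x' * v $ x' / (r * v $ \<kappa> y)" for y x'
    unfolding Q[symmetric] row_sum_on_def P_def
    by (simp add: sum_distrib_right sum_divide_distrib)
  have row: "(\<Sum>y'\<in>UNIV. P $ y $ y') = 1" for y
  proof -
    have "(\<Sum>y'\<in>UNIV. P $ y $ y') = (\<Sum>x'\<in>UNIV. row_sum_on P y (fibre \<kappa> x'))"
      unfolding row_sum_on_def fibre_def vimage_def
      using sum.group[of UNIV UNIV \<kappa> "\<lambda>y'. P $ y $ y'"] by simp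
    also have "\<dots> = (Q *v v) $ \<kappa> y / (r * v $ \<kappa> y)"
      by (simp add: block sum_divide_distrib matrix_vector_mult_def)
    also have "\<dots> = 1" using r v[of "\<kappa> y"] by (simp add: eig)
    finally show ?thesis .
  qed
  have entry_pos: "P $ y $ y' > 0" if "(y, y') \<in> E" for y y'
    using positive_lumpableD(1)[OF F that] v r by (simp add: P_def)
  have entry_zero: "P $ y $ y' = 0" if "(y, y') \<notin> E" for y y'
    using positive_lumpableD(2)[OF F that] by (simp add: P_def)
  have "P \<in> lumpable \<kappa> E"
    unfolding lumpable_def stoch_def pos_edge_funs_def edge_funs_def
    using entry_pos entry_zero row by (auto simp: block)
  moreover have "ln (P $ y $ y') = ln (F $ y $ y') + ln (v $ \<kappa> y') - ln (v $ \<kappa> y) + (- ln r)"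
    if "(y, y') \<in> E" for y y'
    using positive_lumpableD(1)[OF F that] v[of "\<kappa> y"] v[of "\<kappa> y'"] r
    by (simp add: P_def ln_div ln_mult)
  ultimately show thesis
    by (rule that[where g="\<lambda>y. ln (v $ \<kappa> y)" and c="- ln r"])
qed

section \<open>E-families on the logarithmic scale\<close>

definition log_mat :: "real^'y^'y::finite \<Rightarrow> real^'y^'y" where
  "log_mat F = (\<chi> y y'. ln (F $ y $ y'))"

text \<open>
  Once the rescaled matrix is known to be positive on \<open>E\<close>, replacing the eigenvector and the
  eigenvalue by their absolute values does not change it, and the logarithm splits. This makes the
  identity independent of which eigenvector is chosen, and of its signs.
\<close>

lemma ln_stoch_rescale:
  assumes "stoch_rescale (exp_on E H) \<in> stoch E"
  obtains f c where "\<And>y y'. (y, y') \<in> E \<Longrightarrow>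
    ln (stoch_rescale (exp_on E H) $ y $ y') = H $ y $ y' + f y' - f y + c"
proof (rule that[where f="\<lambda>y. ln \<bar>pf_vec (exp_on E H) $ y\<bar>" and c="- ln \<bar>pf_root (exp_on E H)\<bar>"])
  fix y y' assume e: "(y, y') \<in> E"
  define r where "r = pf_root (exp_on E H)"
  define v where "v = pf_vec (exp_on E H)"
  have eq: "stoch_rescale (exp_on E H) $ y $ y' = exp (H $ y $ y') * v $ y' / (r * v $ y)"
    using e by (simp add: stoch_rescale_def exp_on_def r_def v_def)
  have pos: "exp (H $ y $ y') * v $ y' / (r * v $ y) > 0"
    using assms e unfolding eq[symmetric] stoch_def pos_edge_funs_def by blast
  then have nz: "v $ y' \<noteq> 0" "r \<noteq> 0" "v $ y \<noteq> 0" by auto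
  have "exp (H $ y $ y') * v $ y' / (r * v $ y) = exp (H $ y $ y') * \<bar>v $ y'\<bar> / (\<bar>r\<bar> * \<bar>v $ y\<bar>)"
    using abs_of_pos[OF pos] by (simp add: abs_mult)
  then have "ln (stoch_rescale (exp_on E H) $ y $ y')
      = H $ y $ y' + ln \<bar>v $ y'\<bar> - ln \<bar>v $ y\<bar> + (- ln \<bar>r\<bar>)"
    using nz by (simp add: eq ln_div ln_mult)
  then show "ln (stoch_rescale (exp_on E H) $ y $ y') = H $ y $ y'
      + ln \<bar>pf_vec (exp_on E H) $ y'\<bar> - (ln \<bar>pf_vec (exp_on E H) $ y\<bar>)
      + (- ln \<bar>pf_root (exp_on E H)\<bar>)"
    by (simp add: r_def v_def)
qed

text \<open>
  \<open>T\<close> plays the role of the span of the generators of an e-family \<open>V\<close> together with the matrices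
  \<open>f y' - f y + c\<close>, and \<open>K\<close> that of its carrier. The second clause also puts into \<open>T\<close> all matrices
  that vanish on \<open>E\<close>, so membership in \<open>T\<close> depends on the entries on \<open>E\<close> only.
\<close>

definition log_affine ::
  "('y \<times> 'y) set \<Rightarrow> (real^'y^'y::finite) set \<Rightarrow> real^'y^'y \<Rightarrow> (real^'y^'y) set \<Rightarrow> bool" where
  "log_affine E V K T \<longleftrightarrow> subspace T
     \<and> (\<forall>H f c. (\<forall>(y, y') \<in> E. H $ y $ y' = f y' - f y + c) \<longrightarrow> H \<in> T)
     \<and> (\<forall>P \<in> V. log_mat P - K \<in> T)
     \<and> (\<forall>H \<in> T. \<exists>P \<in> V. \<exists>f c. \<forall>(y, y') \<in> E.
          K $ y $ y' + H $ y $ y' = ln (P $ y $ y') + f y' - f y + c)"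

lemma log_affineD:
  assumes "log_affine E V K T"
  shows "subspace T"
    and "(\<And>y y'. (y, y') \<in> E \<Longrightarrow> H $ y $ y' = f y' - f y + c) \<Longrightarrow> H \<in> T"
    and "P \<in> V \<Longrightarrow> log_mat P - K \<in> T"
    and "H \<in> T \<Longrightarrow> \<exists>P \<in> V. \<exists>f c. \<forall>(y, y') \<in> E.
      K $ y $ y' + H $ y $ y' = ln (P $ y $ y') + f y' - f y + c"
proof -
  note T = assms[unfolded log_affine_def]
  show "subspace T" using T by blast
  show "H \<in> T" if "\<And>y y'. (y, y') \<in> E \<Longrightarrow> H $ y $ y' = f y' - f y + c"
    using T[THEN conjunct2, THEN conjunct1, rule_format, of H f c] that by blast
  show "log_mat P - K \<in> T" if "P \<in> V" using T that by blast
  show "\<exists>P \<in> V. \<exists>f c. \<forall>(y, y') \<in> E.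
      K $ y $ y' + H $ y $ y' = ln (P $ y $ y') + f y' - f y + c" if "H \<in> T"
    using T that by blast
qed

text \<open>
  Taking logarithms turns the rescaling into the addition of a term \<open>f y' - f y + c\<close>. This holds for
  every parameter, so the inclusion of \<open>V\<close> in \<open>K + T\<close> can also be read backwards.
\<close>

lemma e_family_imp_log_affine:
  assumes "e_family E V"
  obtains K T where "log_affine E V K T"
proof -
  obtain d K G where VE: "V \<subseteq> stoch E"
    and V: "V = {stoch_rescale (exp_on E (K + (\<Sum>i<d. \<theta> i *\<^sub>R G i))) | \<theta> :: nat \<Rightarrow> real. True}"
    using assms by (auto simp: e_family_def e_family_of_dim_def)
  define M where "M \<theta> = K + (\<Sum>i<d. \<theta> i *\<^sub>R G i)" for \<theta> :: "nat \<Rightarrow> real"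
  have M: "M \<theta> $ y $ y' = K $ y $ y' + (\<Sum>i<d. \<theta> i * G i $ y $ y')" for \<theta> y y'
    by (simp add: M_def)
  have mem: "stoch_rescale (exp_on E (M \<theta>)) \<in> V" for \<theta>
    unfolding V M_def by blast
  define T where "T = {H. \<exists>\<theta> f c. \<forall>(y, y') \<in> E.
    H $ y $ y' = (\<Sum>i<d. \<theta> i * G i $ y $ y') + f y' - f y + c}"
  have TI: "H \<in> T" if "\<And>y y'. (y, y') \<in> E \<Longrightarrow>
      H $ y $ y' = (\<Sum>i<d. \<theta> i * G i $ y $ y') + f y' - f y + c" for H \<theta> f c
    unfolding T_def using that by blast
  have TE: "\<exists>\<theta> f c. \<forall>y y'. (y, y') \<in> E \<longrightarrow>
      H $ y $ y' = (\<Sum>i<d. \<theta> i * G i $ y $ y') + f y' - f y + c" if "H \<in> T" for H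
    using that unfolding T_def by blast
  have T: "subspace T"
  proof (rule subspaceI)
    show "0 \<in> T" by (rule TI[where \<theta>="\<lambda>_. 0" and f="\<lambda>_. 0" and c=0]) simp
  next
    fix H H' assume HT: "H \<in> T" "H' \<in> T"
    obtain \<theta> f c where
      "\<And>y y'. (y, y') \<in> E \<Longrightarrow> H $ y $ y' = (\<Sum>i<d. \<theta> i * G i $ y $ y') + f y' - f y + c"
      using TE[OF HT(1)] by blast
    moreover obtain \<theta>' f' c' where
      "\<And>y y'. (y, y') \<in> E \<Longrightarrow> H' $ y $ y' = (\<Sum>i<d. \<theta>' i * G i $ y $ y') + f' y' - f' y + c'"
      using TE[OF HT(2)] by blast
    ultimately show "H + H' \<in> T"
      by (intro TI[where \<theta>="\<lambda>i. \<theta> i + \<theta>' i" and f="\<lambda>y. f y + f' y" and c="c + c'"])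
        (simp add: distrib_right sum.distrib)
  next
    fix a H assume HT: "H \<in> T"
    obtain \<theta> f c where
      "\<And>y y'. (y, y') \<in> E \<Longrightarrow> H $ y $ y' = (\<Sum>i<d. \<theta> i * G i $ y $ y') + f y' - f y + c"
      using TE[OF HT] by blast
    then show "a *\<^sub>R H \<in> T"
      by (intro TI[where \<theta>="\<lambda>i. a * \<theta> i" and f="\<lambda>y. a * f y" and c="a * c"])
        (simp add: distrib_left right_diff_distrib sum_distrib_left mult.assoc)
  qed
  have TN: "H \<in> T" if "\<forall>(y, y') \<in> E. H $ y $ y' = f y' - f y + c" for H f c
    by (rule TI[where \<theta>="\<lambda>_. 0" and f=f and c=c]) (use that in auto)
  have TV: "log_mat P - K \<in> T" if P: "P \<in> V" for P
  proof -
    obtain \<theta> where \<theta>: "P = stoch_rescale (exp_on E (M \<theta>))"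
      using P unfolding V M_def by blast
    have "stoch_rescale (exp_on E (M \<theta>)) \<in> stoch E" using mem VE by blast
    then obtain f c where "\<And>y y'. (y, y') \<in> E \<Longrightarrow>
        ln (P $ y $ y') = M \<theta> $ y $ y' + f y' - f y + c"
      using ln_stoch_rescale unfolding \<theta> by blast
    then show ?thesis
      by (intro TI[where \<theta>=\<theta> and f=f and c=c]) (simp add: log_mat_def M)
  qed
  have VT: "\<exists>P \<in> V. \<exists>f c. \<forall>(y, y') \<in> E.
      K $ y $ y' + H $ y $ y' = ln (P $ y $ y') + f y' - f y + c" if HT: "H \<in> T" for H
  proof -
    obtain \<theta> f c where
      H: "\<And>y y'. (y, y') \<in> E \<Longrightarrow> H $ y $ y' = (\<Sum>i<d. \<theta> i * G i $ y $ y') + f y' - f y + c"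
      using TE[OF HT] by blast
    define P where "P = stoch_rescale (exp_on E (M \<theta>))"
    have P: "P \<in> V" unfolding P_def by (rule mem)
    have "stoch_rescale (exp_on E (M \<theta>)) \<in> stoch E" using mem VE by blast
    then obtain g b where "\<And>y y'. (y, y') \<in> E \<Longrightarrow>
        ln (P $ y $ y') = M \<theta> $ y $ y' + g y' - g y + b"
      using ln_stoch_rescale unfolding P_def by blast
    with H have "\<forall>(y, y') \<in> E. K $ y $ y' + H $ y $ y'
        = ln (P $ y $ y') + (f y' - g y') - (f y - g y) + (c - b)"
      by (auto simp: M)
    with P show ?thesis
      by (intro bexI[of _ P] exI[of _ "\<lambda>y. f y - g y"] exI[of _ "c - b"])
  qed
  have "log_affine E V K T"
    unfolding log_affine_def by (intro conjI allI ballI impI; (rule T TV VT | erule TN))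
  then show thesis by (rule that)
qed

section \<open>Directions in the logarithmic span of the lumpable kernels\<close>

lemma log_affine_cong:
  assumes T: "log_affine E V K T" and "H \<in> T"
    and "\<And>y y'. (y, y') \<in> E \<Longrightarrow> H' $ y $ y' = H $ y $ y'"
  shows "H' \<in> T"
proof -
  have "H' - H \<in> T"
    by (rule log_affineD(2)[OF T, where f="\<lambda>_. 0" and c=0]) (simp add: assms(3))
  moreover have "subspace T" by (rule log_affineD[OF T])
  ultimately have "(H' - H) + H \<in> T" using assms(2) subspace_add by blast
  then show ?thesis by simp
qed

text \<open>
  The passage from stochastic to arbitrary positive lumpable functions costs only a term
  \<open>g y' - g y + c\<close>, which lies in \<open>T\<close>.
\<close>

lemma log_affine_positive_lumpable:
  fixes E :: "('y::finite \<times> 'y) set" and \<kappa> :: "'y \<Rightarrow> 'x::finite"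
  assumes "E \<noteq> {}" and "strongly_connected E" and "surj \<kappa>"
    and T: "log_affine E (lumpable \<kappa> E) K T" and F: "F \<in> positive_lumpable \<kappa> E"
  shows "log_mat F - K \<in> T"
proof -
  obtain P g c where P: "P \<in> lumpable \<kappa> E"
    and ln: "\<And>y y'. (y, y') \<in> E \<Longrightarrow> ln (P $ y $ y') = ln (F $ y $ y') + g y' - g y + c"
    using lumpable_rescaling_exists[OF assms(1-3) F] by blast
  have sub: "subspace T" by (rule log_affineD[OF T])
  have "log_mat P - log_mat F \<in> T"
    by (rule log_affineD(2)[OF T, where f=g and c=c]) (simp add: log_mat_def ln)
  moreover have "log_mat P - K \<in> T" by (rule log_affineD(3)[OF T P])
  ultimately have "(log_mat P - K) - (log_mat P - log_mat F) \<in> T"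
    using sub subspace_diff by blast
  then show ?thesis by simp
qed

lemma log_affine_diff:
  fixes E :: "('y::finite \<times> 'y) set" and \<kappa> :: "'y \<Rightarrow> 'x::finite"
  assumes "E \<noteq> {}" and "strongly_connected E" and "surj \<kappa>"
    and T: "log_affine E (lumpable \<kappa> E) K T"
    and "F \<in> positive_lumpable \<kappa> E" and "F' \<in> positive_lumpable \<kappa> E"
  shows "log_mat F - log_mat F' \<in> T"
proof -
  have "subspace T" by (rule log_affineD[OF T])
  then have "(log_mat F - K) - (log_mat F' - K) \<in> T"
    using subspace_diff log_affine_positive_lumpable[OF assms(1-4)] assms(5,6) by blast
  then show ?thesis by simp
qed

lemma block_constant_mem:
  fixes E :: "('y::finite \<times> 'y) set" and \<kappa> :: "'y \<Rightarrow> 'x::finite"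
  assumes "E \<noteq> {}" and "strongly_connected E" and "surj \<kappa>"
    and T: "log_affine E (lumpable \<kappa> E) K T" and F: "F \<in> positive_lumpable \<kappa> E"
  shows "(\<chi> y y'. g (\<kappa> y) (\<kappa> y')) \<in> T"
proof (rule log_affine_cong[OF T])
  show "log_mat (\<chi> y y'. exp (g (\<kappa> y) (\<kappa> y')) * F $ y $ y') - log_mat F \<in> T"
    by (rule log_affine_diff[OF assms(1-4) positive_lumpable_scale_blocks[OF F] F])
  show "(\<chi> y y'. g (\<kappa> y) (\<kappa> y')) $ y $ y'
      = (log_mat (\<chi> y y'. exp (g (\<kappa> y) (\<kappa> y')) * F $ y $ y') - log_mat F) $ y $ y'"
    if "(y, y') \<in> E" for y y'
    using positive_lumpableD(1)[OF F that] by (simp add: log_mat_def ln_mult)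
qed

text \<open>
  The mass on the two edges is first split evenly, then moved by half of the even share in either
  direction. The two logarithmic differences have the entries \<open>(p, q)\<close> and \<open>(q, p)\<close> at the two edges,
  with \<open>p = ln (3/2)\<close> and \<open>q = ln (1/2)\<close>. As \<open>p\<^sup>2 \<noteq> q\<^sup>2\<close>, they are linearly independent and their
  span contains the unit matrix of one edge.
\<close>

lemma unit_matrix_mem:
  fixes E :: "('y::finite \<times> 'y) set" and \<kappa> :: "'y \<Rightarrow> 'x::finite"
  assumes "E \<noteq> {}" and "strongly_connected E" and "surj \<kappa>"
    and T: "log_affine E (lumpable \<kappa> E) K T" and F: "F \<in> positive_lumpable \<kappa> E"
    and ab: "(y0, a) \<in> E" "(y0, b) \<in> E" "\<kappa> a = \<kappa> b" "a \<noteq> b"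
  shows "(\<chi> y y'. if y = y0 \<and> y' = a then 1 else 0) \<in> T" (is "?U \<in> T")
proof -
  define shift :: "real \<Rightarrow> real^'y^'y" where
    "shift u = (\<chi> y y'. F $ y $ y' + (if y = y0 \<and> y' = a then u else 0)
      - (if y = y0 \<and> y' = b then u else 0))" for u
  \<comment> \<open>Shifting by m makes both entries equal to h.\<close>
  define m where "m = (F $ y0 $ b - F $ y0 $ a) / 2"
  define h where "h = (F $ y0 $ a + F $ y0 $ b) / 2"
  have pos: "F $ y0 $ a > 0" "F $ y0 $ b > 0" using positive_lumpableD(1)[OF F] ab by auto
  then have h: "h > 0" by (simp add: h_def)
  have mem: "shift u \<in> positive_lumpable \<kappa> E" if "- F $ y0 $ a < u" "u < F $ y0 $ b" for u
    unfolding shift_def using positive_lumpable_shift[OF F ab(1-3) that] by simp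
  have mem3: "shift m \<in> positive_lumpable \<kappa> E" "shift (m + h / 2) \<in> positive_lumpable \<kappa> E"
      "shift (m - h / 2) \<in> positive_lumpable \<kappa> E"
    using pos by (auto intro!: mem simp: m_def h_def field_simps)
  define p q :: real where "p = ln (3 / 2)" and "q = ln (1 / 2)"
  define X Z where "X = log_mat (shift (m + h / 2)) - log_mat (shift m)"
    and "Z = log_mat (shift (m - h / 2)) - log_mat (shift m)"
  have "X \<in> T" "Z \<in> T"
    unfolding X_def Z_def using log_affine_diff[OF assms(1-4)] mem3 by auto
  moreover have sub: "subspace T" by (rule log_affineD[OF T])
  ultimately have "p *\<^sub>R X - q *\<^sub>R Z \<in> T"
    using subspace_diff subspace_scale by blast
  then have in_T: "(1 / (p\<^sup>2 - q\<^sup>2)) *\<^sub>R (p *\<^sub>R X - q *\<^sub>R Z) \<in> T"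
    using sub subspace_scale by blast
  have vals: "shift m $ y0 $ a = h" "shift m $ y0 $ b = h"
      "shift (m + h / 2) $ y0 $ a = 3 / 2 * h" "shift (m + h / 2) $ y0 $ b = 1 / 2 * h"
      "shift (m - h / 2) $ y0 $ a = 1 / 2 * h" "shift (m - h / 2) $ y0 $ b = 3 / 2 * h"
    using ab(4) by (simp_all add: shift_def m_def h_def field_simps)
  have ratio: "ln (3 / 2 * h) - ln h = p" "ln (1 / 2 * h) - ln h = q"
    unfolding p_def q_def using h by (simp_all only: ln_mult) simp_all
  have "X $ y0 $ a = p" "X $ y0 $ b = q" "Z $ y0 $ a = q" "Z $ y0 $ b = p"
    unfolding X_def Z_def log_mat_def vector_minus_component vec_lambda_beta vals
    by (fact ratio)+
  moreover have "X $ y $ y' = 0" "Z $ y $ y' = 0" if "\<not> (y = y0 \<and> (y' = a \<or> y' = b))" for y y'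
    using that by (auto simp: X_def Z_def log_mat_def shift_def)
  moreover have "p\<^sup>2 - q\<^sup>2 \<noteq> 0"
  proof -
    have "p > 0" "q = - ln 2" by (simp_all add: p_def q_def ln_div)
    moreover have "p < ln 2" by (simp add: p_def)
    ultimately have "p\<^sup>2 < q\<^sup>2" by (simp add: power_strict_mono)
    then show ?thesis by simp
  qed
  ultimately have "?U $ y $ y' = ((1 / (p\<^sup>2 - q\<^sup>2)) *\<^sub>R (p *\<^sub>R X - q *\<^sub>R Z)) $ y $ y'" for y y'
    using ab(4) by (cases "y = y0 \<and> (y' = a \<or> y' = b)") (auto simp: power2_eq_square mult.commute)
  then show ?thesis by (intro log_affine_cong[OF T in_T])
qed

lemma multi_pts_iff:
  "y \<in> multi_pts \<kappa> E x x' \<longleftrightarrow> \<kappa> y = x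
    \<and> (\<exists>y1 y2. \<kappa> y1 = x' \<and> \<kappa> y2 = x' \<and> y1 \<noteq> y2 \<and> (y, y1) \<in> E \<and> (y, y2) \<in> E)"
  by (auto simp: multi_pts_def Bex_def)

text \<open>
  The edges in \<open>R_set\<close> are those that share their source and the fibre of their target with another
  edge: exactly these carry mass that can be moved inside a block sum.
\<close>

lemma R_set_iff:
  "(y, y') \<in> R_set \<kappa> E \<longleftrightarrow> (y, y') \<in> E \<and> (\<exists>b. b \<noteq> y' \<and> \<kappa> b = \<kappa> y' \<and> (y, b) \<in> E)"
proof
  assume "(y, y') \<in> R_set \<kappa> E"
  then obtain x where "(y, y') \<in> E" "y \<in> multi_pts \<kappa> E x (\<kappa> y')"
    by (auto simp: R_set_def)
  then show "(y, y') \<in> E \<and> (\<exists>b. b \<noteq> y' \<and> \<kappa> b = \<kappa> y' \<and> (y, b) \<in> E)"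
    unfolding multi_pts_iff by metis
next
  assume A: "(y, y') \<in> E \<and> (\<exists>b. b \<noteq> y' \<and> \<kappa> b = \<kappa> y' \<and> (y, b) \<in> E)"
  then have "y \<in> multi_pts \<kappa> E (\<kappa> y) (\<kappa> y')"
    unfolding multi_pts_iff by metis
  moreover from this have "(\<kappa> y, \<kappa> y') \<in> M_set \<kappa> E"
    using A by (auto simp: M_set_def intro: lumped_edgesI)
  ultimately show "(y, y') \<in> R_set \<kappa> E" using A unfolding R_set_def by force
qed

text \<open>
  On \<open>E\<close>, \<open>H\<close> is the sum of a block-constant matrix and multiples of unit matrices of edges in
  \<open>R_set\<close>.
\<close>

lemma tangent_mem:
  fixes E :: "('y::finite \<times> 'y) set" and \<kappa> :: "'y \<Rightarrow> 'x::finite"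
  assumes "E \<noteq> {}" and "strongly_connected E" and "surj \<kappa>"
    and T: "log_affine E (lumpable \<kappa> E) K T" and F: "F \<in> positive_lumpable \<kappa> E"
    and H: "\<And>y y'. (y, y') \<in> E - R_set \<kappa> E \<Longrightarrow> H $ y $ y' = g (\<kappa> y) (\<kappa> y')"
  shows "H \<in> T"
proof (rule log_affine_cong[OF T])
  define unit :: "'y \<times> 'y \<Rightarrow> real^'y^'y" where
    "unit e = (\<chi> y y'. if y = fst e \<and> y' = snd e then 1 else 0)" for e
  define c where "c e = H $ fst e $ snd e - g (\<kappa> (fst e)) (\<kappa> (snd e))" for e
  define B where "B = (\<chi> y y'. g (\<kappa> y) (\<kappa> y'))"
  have sub: "subspace T" by (rule log_affineD[OF T])
  have "unit e \<in> T" if "e \<in> R_set \<kappa> E" for e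
  proof -
    obtain y0 a where e: "e = (y0, a)" by (cases e)
    with that obtain b where "(y0, a) \<in> E" "(y0, b) \<in> E" "\<kappa> a = \<kappa> b" "a \<noteq> b"
      by (auto simp: R_set_iff)
    from unit_matrix_mem[OF assms(1-5) this] show ?thesis by (simp add: unit_def e)
  qed
  then show "B + (\<Sum>e\<in>R_set \<kappa> E. c e *\<^sub>R unit e) \<in> T"
    unfolding B_def using sub block_constant_mem[OF assms(1-5), of g]
    by (intro subspace_add subspace_sum subspace_scale) auto
  fix y y' assume e: "(y, y') \<in> E"
  have "(\<Sum>e\<in>R_set \<kappa> E. c e *\<^sub>R unit e) $ y $ y' = (\<Sum>e\<in>R_set \<kappa> E. if e = (y, y') then c e else 0)"
    unfolding sum_component by (rule sum.cong) (auto simp: unit_def)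
  also have "\<dots> = (if (y, y') \<in> R_set \<kappa> E then c (y, y') else 0)" by simp
  finally show "H $ y $ y' = (B + (\<Sum>e\<in>R_set \<kappa> E. c e *\<^sub>R unit e)) $ y $ y'"
    using H[of y y'] e by (simp add: B_def c_def)
qed

section \<open>The dimension of the space of lumpable functions\<close>

lemma dim_supported_vectors:
  "dim {x :: real^'n::finite. \<forall>i. i \<notin> d \<longrightarrow> x $ i = 0} = card d"
  using dim_substandard_cart[where 'a=real and 'n='n, of d] by (simp add: dim_vec_eq)

text \<open>
  The linear constraints that positive lumpable functions satisfy. Pairs index the coordinates, so
  that the dimension of a coordinate subspace is the size of a set of edges.
\<close>

definition lumpable_space ::
  "('y \<Rightarrow> 'x) \<Rightarrow> ('y \<times> 'y) set \<Rightarrow> (real^('y::finite \<times> 'y)) set" where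
  "lumpable_space \<kappa> E = {F. (\<forall>e. e \<notin> E \<longrightarrow> F $ e = 0) \<and>
     (\<forall>y1 y2 x'. \<kappa> y1 = \<kappa> y2 \<longrightarrow>
       (\<Sum>y'\<in>fibre \<kappa> x'. F $ (y1, y')) = (\<Sum>y'\<in>fibre \<kappa> x'. F $ (y2, y')))}"

lemma lumpable_spaceD:
  assumes "F \<in> lumpable_space \<kappa> E"
  shows "e \<notin> E \<Longrightarrow> F $ e = 0"
    and "\<kappa> y1 = \<kappa> y2 \<Longrightarrow>
      (\<Sum>y'\<in>fibre \<kappa> x'. F $ (y1, y')) = (\<Sum>y'\<in>fibre \<kappa> x'. F $ (y2, y'))"
  using assms unfolding lumpable_space_def by blast+

lemma lumpable_spaceI:
  assumes "\<And>e. e \<notin> E \<Longrightarrow> F $ e = 0"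
    and "\<And>y1 y2 x'. \<kappa> y1 = \<kappa> y2 \<Longrightarrow>
      (\<Sum>y'\<in>fibre \<kappa> x'. F $ (y1, y')) = (\<Sum>y'\<in>fibre \<kappa> x'. F $ (y2, y'))"
  shows "F \<in> lumpable_space \<kappa> E"
  using assms unfolding lumpable_space_def by blast

lemma subspace_lumpable_space: "subspace (lumpable_space \<kappa> E)"
proof (rule subspaceI)
  show "0 \<in> lumpable_space \<kappa> E" by (rule lumpable_spaceI) simp_all
next
  fix F G assume F: "F \<in> lumpable_space \<kappa> E" and G: "G \<in> lumpable_space \<kappa> E"
  show "F + G \<in> lumpable_space \<kappa> E"
  proof (rule lumpable_spaceI)
    fix y1 y2 x' assume eq: "\<kappa> y1 = \<kappa> y2"
    show "(\<Sum>y'\<in>fibre \<kappa> x'. (F + G) $ (y1, y')) = (\<Sum>y'\<in>fibre \<kappa> x'. (F + G) $ (y2, y'))"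
      using lumpable_spaceD(2)[OF F eq, of x'] lumpable_spaceD(2)[OF G eq, of x']
      by (simp add: sum.distrib)
  qed (use lumpable_spaceD(1)[OF F] lumpable_spaceD(1)[OF G] in simp)
next
  fix a F assume F: "F \<in> lumpable_space \<kappa> E"
  show "a *\<^sub>R F \<in> lumpable_space \<kappa> E"
  proof (rule lumpable_spaceI)
    fix y1 y2 x' assume eq: "\<kappa> y1 = \<kappa> y2"
    show "(\<Sum>y'\<in>fibre \<kappa> x'. (a *\<^sub>R F) $ (y1, y')) = (\<Sum>y'\<in>fibre \<kappa> x'. (a *\<^sub>R F) $ (y2, y'))"
      using lumpable_spaceD(2)[OF F eq, of x'] by (simp add: sum_distrib_left[symmetric])
  qed (use lumpable_spaceD(1)[OF F] in simp)
qed

text \<open>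
  In a block \<open>(x, x')\<close> one point of \<open>fibre \<kappa> x\<close> keeps all its entries free and fixes the block sum; at
  each of the other \<open>card (fibre \<kappa> x) - 1\<close> points one entry is determined by the rest. The
  projection that forgets these determined entries is injective.
\<close>

lemma dim_lumpable_space_le:
  fixes E :: "('y::finite \<times> 'y) set" and \<kappa> :: "'y \<Rightarrow> 'x::finite"
  assumes "surj \<kappa>" and F0: "F0 \<in> positive_lumpable \<kappa> E"
  shows "int (dim (lumpable_space \<kappa> E)) \<le> int (card E)
    - (\<Sum>(x, x') \<in> lumped_edges \<kappa> E. int (card (fibre \<kappa> x))) + int (card (lumped_edges \<kappa> E))"
proof -
  define D where "D = lumped_edges \<kappa> E"
  define rep where "rep = inv \<kappa>"
  have rep: "\<kappa> (rep x) = x" for x using \<open>surj \<kappa>\<close> by (simp add: rep_def surj_f_inv_f)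
  have "\<forall>z. \<exists>y'. (\<kappa> (fst z), snd z) \<in> D \<longrightarrow> \<kappa> y' = snd z \<and> (fst z, y') \<in> E"
    using edge_into_fibre[OF F0] unfolding D_def by blast
  then obtain \<eta> where \<eta>: "\<And>y x'. (\<kappa> y, x') \<in> D \<Longrightarrow> \<kappa> (\<eta> (y, x')) = x' \<and> (y, \<eta> (y, x')) \<in> E"
    by (metis fst_conv snd_conv)
  \<comment> \<open>A is the set of pairs of a point and a fibre it has edges into, A0 the pairs whose point is the
    representative of its own fibre, and dep the set of the determined edges.\<close>
  define A where "A = {(y, x'). (\<kappa> y, x') \<in> D}"
  have \<eta>A: "\<kappa> (\<eta> (y, x')) = x'" "(y, \<eta> (y, x')) \<in> E" if "(y, x') \<in> A" for y x'
    using \<eta> that unfolding A_def by blast+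
  define A0 where "A0 = (\<lambda>(x, x'). (rep x, x')) ` D"
  define dep where "dep = (\<lambda>(y, x'). (y, \<eta> (y, x'))) ` (A - A0)"
  have A0: "A0 \<subseteq> A" by (auto simp: A0_def A_def rep)
  have "inj_on (\<lambda>(x, x'). (rep x, x')) D"
    by (rule inj_onI) (auto dest: arg_cong[of _ _ \<kappa>] simp: rep)
  then have card_A0: "card A0 = card D" unfolding A0_def by (rule card_image)
  have "A = (\<lambda>(u, y). (y, snd u)) ` (SIGMA u:D. fibre \<kappa> (fst u))"
    by (force simp: A_def image_iff)
  moreover have "inj_on (\<lambda>(u, y). (y, snd u)) (SIGMA u:D. fibre \<kappa> (fst u))"
    by (rule inj_onI) auto
  ultimately have "card A = (\<Sum>u\<in>D. card (fibre \<kappa> (fst u)))"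
    by (simp add: card_image)
  then have card_A: "int (card A) = (\<Sum>(x, x')\<in>D. int (card (fibre \<kappa> x)))"
    by (simp add: case_prod_unfold)
  have "inj_on (\<lambda>(y, x'). (y, \<eta> (y, x'))) (A - A0)"
  proof (rule inj_onI)
    fix z w assume z: "z \<in> A - A0" and w: "w \<in> A - A0"
      and eq: "(case z of (y, x') \<Rightarrow> (y, \<eta> (y, x'))) = (case w of (y, x') \<Rightarrow> (y, \<eta> (y, x')))"
    obtain y x1 x2 where "z = (y, x1)" "w = (y, x2)" "\<eta> (y, x1) = \<eta> (y, x2)"
      using eq by (cases z, cases w) auto
    then show "z = w" using z w by (metis DiffD1 \<eta>A(1))
  qed
  then have "card dep = card (A - A0)" unfolding dep_def by (rule card_image)
  also have "\<dots> = card A - card A0" using A0 by (simp add: card_Diff_subset)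
  finally have card_dep: "int (card dep) = int (card A) - int (card D)"
    using card_mono[OF _ A0] card_A0 by simp
  have dep: "dep \<subseteq> E" using \<eta>A(2) by (auto simp: dep_def)
  then have card_rest: "int (card (E - dep)) = int (card E) - int (card dep)"
    using card_mono[OF _ dep] by (simp add: card_Diff_subset)
  define p :: "real^('y \<times> 'y) \<Rightarrow> real^('y \<times> 'y)"
    where "p F = (\<chi> e. if e \<in> E - dep then F $ e else 0)" for F
  have "linear p" by (rule linearI) (auto simp: p_def vec_eq_iff)
  moreover have "inj_on p (lumpable_space \<kappa> E)"
  proof (rule linear_inj_on_iff_eq_0[THEN iffD2, OF \<open>linear p\<close> subspace_lumpable_space], intro ballI impI)
    fix F assume F: "F \<in> lumpable_space \<kappa> E" and "p F = 0"
    have off: "F $ e = 0" if "e \<notin> dep" for e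
    proof (cases "e \<in> E")
      case True
      have "p F $ e = 0" using \<open>p F = 0\<close> by simp
      then show ?thesis using True that by (simp add: p_def)
    qed (rule lumpable_spaceD(1)[OF F])
    have "F $ (y, y') = 0" for y y'
    proof (cases "(y, y') \<in> dep")
      case True
      define x' where "x' = \<kappa> y'"
      obtain x1 where x1: "(y, x1) \<in> A" "y' = \<eta> (y, x1)" using True by (auto simp: dep_def)
      then have "x1 = x'" using \<eta>A(1)[of y x1] by (simp add: x'_def)
      have "(\<Sum>z\<in>fibre \<kappa> x'. F $ (rep (\<kappa> y), z)) = 0"
      proof (rule sum.neutral, rule ballI)
        fix z
        have "(rep (\<kappa> y), z) \<notin> dep"
        proof
          assume "(rep (\<kappa> y), z) \<in> dep"
          then obtain x2 where "(rep (\<kappa> y), x2) \<in> A" "(rep (\<kappa> y), x2) \<notin> A0"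
            by (auto simp: dep_def)
          then show False by (force simp: A_def A0_def rep)
        qed
        then show "F $ (rep (\<kappa> y), z) = 0" by (rule off)
      qed
      then have "0 = (\<Sum>z\<in>fibre \<kappa> x'. F $ (y, z))"
        using lumpable_spaceD(2)[OF F, of "rep (\<kappa> y)" y x'] rep by simp
      also have "\<dots> = (\<Sum>z\<in>{y'}. F $ (y, z))"
      proof (rule sum.mono_neutral_right)
        show "\<forall>z\<in>fibre \<kappa> x' - {y'}. F $ (y, z) = 0"
        proof
          fix z assume z: "z \<in> fibre \<kappa> x' - {y'}"
          have "(y, z) \<notin> dep"
          proof
            assume "(y, z) \<in> dep"
            then obtain x2 where x2: "(y, x2) \<in> A" "z = \<eta> (y, x2)" by (auto simp: dep_def)
            then have "x2 = x'" using \<eta>A(1)[of y x2] z by simp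
            then show False using z x2 x1 \<open>x1 = x'\<close> by simp
          qed
          then show "F $ (y, z) = 0" by (rule off)
        qed
      qed (auto simp: x'_def)
      finally show ?thesis by simp
    qed (rule off)
    then show "F = 0" by (simp add: vec_eq_iff)
  qed
  ultimately have "dim (p ` lumpable_space \<kappa> E) = dim (lumpable_space \<kappa> E)"
    by (intro dim_image_eq) (simp_all add: subspace_lumpable_space span_eq_iff[THEN iffD2])
  moreover have "dim (p ` lumpable_space \<kappa> E) \<le> dim {x :: real^('y \<times> 'y). \<forall>i. i \<notin> E - dep \<longrightarrow> x $ i = 0}"
    by (rule dim_subset) (auto simp: p_def)
  ultimately have "int (dim (lumpable_space \<kappa> E)) \<le> int (card (E - dep))"
    unfolding dim_supported_vectors by simp
  then show ?thesis using card_rest card_dep card_A by (simp add: D_def)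
qed

section \<open>Comparison of dimensions\<close>

text \<open>
  A point of \<open>fibre \<kappa> x\<close> outside \<open>multi_pts\<close> has exactly one edge into the fibre over \<open>x'\<close>, and that
  edge is not in \<open>R_set\<close>.
\<close>

lemma U_set_edge:
  assumes F: "F \<in> positive_lumpable \<kappa> E" and u: "(x, x') \<in> U_set \<kappa> E"
  shows "\<exists>y y'. \<kappa> y = x \<and> \<kappa> y' = x' \<and> (y, y') \<in> E - R_set \<kappa> E"
proof -
  have "multi_pts \<kappa> E x x' \<subseteq> fibre \<kappa> x" by (auto simp: multi_pts_def)
  moreover have "multi_pts \<kappa> E x x' \<noteq> fibre \<kappa> x" using u by (simp add: U_set_def)
  ultimately obtain y where "y \<in> fibre \<kappa> x" and y: "y \<notin> multi_pts \<kappa> E x x'" by blast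
  then have y: "\<kappa> y = x" "y \<notin> multi_pts \<kappa> E x x'" by simp_all
  have "(\<kappa> y, x') \<in> lumped_edges \<kappa> E" using u y by (simp add: U_set_def)
  then obtain y' where y': "\<kappa> y' = x'" "(y, y') \<in> E" using edge_into_fibre[OF F] by blast
  then have "(y, y') \<notin> R_set \<kappa> E"
    using y unfolding R_set_iff multi_pts_iff by metis
  with y y' show ?thesis by blast
qed

text \<open>
  Here the dimension of the domain is that of its linear span, which varies with the graph. The span
  is identified linearly with a proper, hence null, subspace of the target, and differentiable maps
  preserve null sets.
\<close>

lemma negligible_differentiable_image_of_low_dim:
  fixes f :: "'a::euclidean_space \<Rightarrow> 'b::euclidean_space"
  assumes "dim S < DIM('b)" and "f differentiable_on S"
  shows "negligible (f ` S)"
proof -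
  obtain T :: "'b set" where T: "subspace T" "dim T = dim S"
    using choose_subspace_of_subspace[of "dim S" "UNIV :: 'b set"] assms(1) by auto
  obtain g :: "'b \<Rightarrow> 'a" where g: "linear g" "g ` T = span S"
    using isometries_subspaces[of T "span S"] T by (metis dim_span subspace_span)
  have "negligible {t \<in> T. g t \<in> S}"
    by (rule negligible_subset[OF negligible_lowdim[of T]]) (use T assms(1) in auto)
  moreover have "(f \<circ> g) differentiable_on {t \<in> T. g t \<in> S}"
    unfolding comp_def
    by (rule differentiable_on_compose[OF linear_imp_differentiable_on[OF g(1)]])
      (auto intro: differentiable_on_subset[OF assms(2)])
  ultimately have "negligible ((f \<circ> g) ` {t \<in> T. g t \<in> S})"
    by (intro negligible_differentiable_image_negligible) auto
  moreover have "f ` S = (f \<circ> g) ` {t \<in> T. g t \<in> S}"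
  proof
    show "f ` S \<subseteq> (f \<circ> g) ` {t \<in> T. g t \<in> S}"
    proof
      fix z assume "z \<in> f ` S"
      then obtain s where s: "s \<in> S" "z = f s" by blast
      then have "s \<in> g ` T" using g(2) span_base by blast
      then obtain t where "t \<in> T" "s = g t" by blast
      with s show "z \<in> (f \<circ> g) ` {t \<in> T. g t \<in> S}" by force
    qed
  qed auto
  ultimately show ?thesis by simp
qed

lemma differentiable_on_vec_lambda:
  fixes f :: "'a::euclidean_space \<Rightarrow> real^'n::finite"
  assumes "\<And>i. (\<lambda>x. f x $ i) differentiable_on S"
  shows "f differentiable_on S"
  unfolding differentiable_on_def
proof (rule ballI, rule differentiable_componentwise_within[THEN iffD2], rule ballI)
  fix x and b :: "real^'n" assume "x \<in> S" "b \<in> Basis"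
  then obtain i where "b = axis i 1" by (auto simp: Basis_vec_def)
  then show "(\<lambda>x. f x \<bullet> b) differentiable at x within S"
    using assms[of i] \<open>x \<in> S\<close> by (simp add: inner_axis differentiable_on_def)
qed

text \<open>
  By \<open>tangent_mem\<close> the matrix \<open>H\<close> lies in \<open>K + T\<close>, hence is \<open>ln P + f y' - f y + c\<close> on \<open>E\<close> with \<open>P\<close>
  lumpable. Normalising \<open>f\<close> to vanish at the representatives \<open>inv \<kappa> x\<close> changes \<open>P\<close> by factors that
  depend on the block only, which is possible within the positive lumpable functions.
\<close>

lemma log_image_attains:
  fixes E :: "('y::finite \<times> 'y) set" and \<kappa> :: "'y \<Rightarrow> 'x::finite"
  assumes "E \<noteq> {}" and "strongly_connected E" and "surj \<kappa>"
    and T: "log_affine E (lumpable \<kappa> E) K T" and F0: "F0 \<in> positive_lumpable \<kappa> E"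
    and H: "\<And>y y'. (y, y') \<in> E - R_set \<kappa> E \<Longrightarrow> H $ y $ y' = ln (F0 $ y $ y') + g (\<kappa> y) (\<kappa> y')"
  obtains F :: "real^('y \<times> 'y)" and f :: "real^'y"
  where "F \<in> lumpable_space \<kappa> E" and "\<And>e. e \<in> E \<Longrightarrow> F $ e > 0"
    and "\<And>x. f $ inv \<kappa> x = 0"
    and "\<And>y y'. (y, y') \<in> E \<Longrightarrow> H $ y $ y' = ln (F $ (y, y')) + f $ y' - f $ y"
proof -
  have sub: "subspace T" by (rule log_affineD[OF T])
  have "H - log_mat F0 \<in> T"
    by (rule tangent_mem[OF assms(1-5), where g=g]) (use H in \<open>simp add: log_mat_def\<close>)
  moreover have "log_mat F0 - K \<in> T" by (rule log_affine_positive_lumpable[OF assms(1-5)])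
  ultimately have "(H - log_mat F0) + (log_mat F0 - K) \<in> T" using sub subspace_add by blast
  then have "H - K \<in> T" by simp
  from log_affineD(4)[OF T this] obtain P f c where P: "P \<in> lumpable \<kappa> E"
    and "\<forall>(y, y') \<in> E. K $ y $ y' + (H - K) $ y $ y' = ln (P $ y $ y') + f y' - f y + c"
    by blast
  then have HP: "H $ y $ y' = ln (P $ y $ y') + f y' - f y + c" if "(y, y') \<in> E" for y y'
    using that by fastforce
  have P': "P \<in> positive_lumpable \<kappa> E" using P by (simp add: lumpable_eq)
  have inv: "\<kappa> (inv \<kappa> x) = x" for x using \<open>surj \<kappa>\<close> by (simp add: surj_f_inv_f)
  define h where "h x = f (inv \<kappa> x)" for x
  define F' where "F' = (\<chi> y y'. exp (c + h (\<kappa> y') - h (\<kappa> y)) * P $ y $ y')"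
  have F': "F' \<in> positive_lumpable \<kappa> E"
    unfolding F'_def
    using positive_lumpable_scale_blocks[OF P', of "\<lambda>x x'. c + h x' - h x"] by simp
  define F :: "real^('y \<times> 'y)" where "F = (\<chi> e. F' $ fst e $ snd e)"
  show thesis
  proof (rule that[of F "\<chi> y. f y - h (\<kappa> y)"])
    show "F \<in> lumpable_space \<kappa> E"
    proof (rule lumpable_spaceI)
      show "F $ e = 0" if "e \<notin> E" for e
        using positive_lumpableD(2)[OF F', of "fst e" "snd e"] that by (simp add: F_def)
      show "(\<Sum>y'\<in>fibre \<kappa> x'. F $ (y1, y')) = (\<Sum>y'\<in>fibre \<kappa> x'. F $ (y2, y'))"
        if "\<kappa> y1 = \<kappa> y2" for y1 y2 x'
        using row_sum_on_fibre_eq[OF F' that, of x'] by (simp add: F_def row_sum_on_def)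
    qed
    show "F $ e > 0" if "e \<in> E" for e
      using positive_lumpableD(1)[OF F', of "fst e" "snd e"] that by (simp add: F_def)
    show "(\<chi> y. f y - h (\<kappa> y)) $ inv \<kappa> x = 0" for x by (simp add: h_def inv)
    show "H $ y $ y' = ln (F $ (y, y')) + (\<chi> y. f y - h (\<kappa> y)) $ y' - (\<chi> y. f y - h (\<kappa> y)) $ y"
      if "(y, y') \<in> E" for y y'
      using positive_lumpableD(1)[OF P' that] HP[OF that] by (simp add: F_def F'_def ln_mult)
  qed
qed

text \<open>
  Let \<open>J\<close> consist of \<open>R_set\<close> and one edge outside it from every block in \<open>U_set\<close>. The map
  \<open>(F, f) \<mapsto> ln F + f y' - f y\<close> attains all values on \<open>J\<close>. A third argument \<open>w\<close>, supported outside \<open>J\<close>,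
  adjusts the other coordinates, so that the combined map is onto the full space of matrices; the
  domain must then have at least full dimension.
\<close>

lemma log_affine_dimension_bound:
  fixes E :: "('y::finite \<times> 'y) set" and \<kappa> :: "'y \<Rightarrow> 'x::finite"
  assumes "E \<noteq> {}" and "strongly_connected E" and "surj \<kappa>"
    and T: "log_affine E (lumpable \<kappa> E) K T" and F0: "F0 \<in> positive_lumpable \<kappa> E"
  shows "card (R_set \<kappa> E) + card (U_set \<kappa> E)
    \<le> dim (lumpable_space \<kappa> E) + (CARD('y) - CARD('x))"
proof (rule ccontr)
  assume less: "\<not> ?thesis"
  have "\<forall>u. \<exists>e. u \<in> U_set \<kappa> E \<longrightarrow> \<kappa> (fst e) = fst u \<and> \<kappa> (snd e) = snd u \<and> e \<in> E - R_set \<kappa> E"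
    using U_set_edge[OF F0] by (metis fst_conv prod.collapse snd_conv)
  then obtain r where r: "\<And>u. u \<in> U_set \<kappa> E \<Longrightarrow>
      \<kappa> (fst (r u)) = fst u \<and> \<kappa> (snd (r u)) = snd u \<and> r u \<in> E - R_set \<kappa> E"
    by metis
  define J where "J = R_set \<kappa> E \<union> r ` U_set \<kappa> E"
  have "inj_on r (U_set \<kappa> E)" by (rule inj_onI) (metis r prod_eqI)
  moreover have "R_set \<kappa> E \<inter> r ` U_set \<kappa> E = {}" using r by blast
  ultimately have card_J: "card J = card (R_set \<kappa> E) + card (U_set \<kappa> E)"
    unfolding J_def by (simp add: card_Un_disjoint card_image)
  have J: "J \<subseteq> E" unfolding J_def using r by (auto simp: R_set_iff)
  define fs where "fs = {f :: real^'y. \<forall>y. y \<notin> - range (inv \<kappa>) \<longrightarrow> f $ y = 0}"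
  define ws where "ws = {w :: real^('y \<times> 'y). \<forall>e. e \<notin> - J \<longrightarrow> w $ e = 0}"
  have "card (range (inv \<kappa>)) = CARD('x)"
    using \<open>surj \<kappa>\<close> by (simp add: card_image surj_imp_inj_inv)
  then have dim_fs: "dim fs = CARD('y) - CARD('x)"
    unfolding fs_def dim_supported_vectors by (simp add: Compl_eq_Diff_UNIV card_Diff_subset)
  have dim_ws: "dim ws = CARD('y \<times> 'y) - card J"
    unfolding ws_def dim_supported_vectors by (simp add: Compl_eq_Diff_UNIV card_Diff_subset)
  have sub: "subspace fs" "subspace ws"
    unfolding fs_def ws_def subspace_def by auto
  define S where "S = {(F, f, w). F \<in> lumpable_space \<kappa> E \<and> (\<forall>e\<in>E. F $ e > 0) \<and> f \<in> fs \<and> w \<in> ws}"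
  define \<Phi> :: "(real^('y \<times> 'y)) \<times> (real^'y) \<times> (real^('y \<times> 'y)) \<Rightarrow> real^('y \<times> 'y)"
    where "\<Phi> = (\<lambda>(F, f, w). \<chi> e. (if e \<in> E then ln (F $ e) + f $ snd e - f $ fst e else 0) + w $ e)"
  have "dim S \<le> dim (lumpable_space \<kappa> E \<times> fs \<times> ws)"
    by (rule dim_subset) (auto simp: S_def)
  also have "\<dots> = dim (lumpable_space \<kappa> E) + (dim fs + dim ws)"
    by (simp only: dim_Times subspace_Times subspace_lumpable_space sub)
  also have "\<dots> < CARD('y \<times> 'y)"
    using less card_mono[of UNIV J] unfolding dim_fs dim_ws card_J by simp
  finally have "dim S < DIM(real^('y \<times> 'y))" by simp
  moreover have "\<Phi> differentiable_on S"
  proof (rule differentiable_on_vec_lambda)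
    fix e
    have lin: "(\<lambda>p. fst p $ e) differentiable_on S" "(\<lambda>p. fst (snd p) $ i) differentiable_on S"
        "(\<lambda>p. snd (snd p) $ e) differentiable_on S" for i
      by (rule linear_imp_differentiable_on, rule linearI, simp_all)+
    show "(\<lambda>p. \<Phi> p $ e) differentiable_on S"
    proof (cases "e \<in> E")
      case True
      have "(\<lambda>p. ln (fst p $ e)) differentiable_on S"
      proof (rule differentiable_on_compose[OF lin(1)])
        show "ln differentiable_on (\<lambda>p. fst p $ e) ` S"
        proof (unfold differentiable_on_def, intro ballI)
          fix t assume "t \<in> (\<lambda>p. fst p $ e) ` S"
          then have "t > 0" using True by (auto simp: S_def)
          then show "ln differentiable at t within (\<lambda>p. fst p $ e) ` S"
            unfolding real_differentiable_def
            using DERIV_ln has_field_derivative_at_within by blast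
        qed
      qed
      then show ?thesis
        using True lin by (simp add: \<Phi>_def case_prod_unfold)
    next
      case False
      then show ?thesis using lin by (simp add: \<Phi>_def case_prod_unfold)
    qed
  qed
  ultimately have "negligible (\<Phi> ` S)" by (rule negligible_differentiable_image_of_low_dim)
  moreover have "z \<in> \<Phi> ` S" for z
  proof -
    \<comment> \<open>On every block of U_set the block constant g is chosen to match z at the edge selected there.\<close>
    define g where "g x x' = z $ r (x, x') - ln (F0 $ fst (r (x, x')) $ snd (r (x, x')))" for x x'
    define H where "H = (\<chi> y y'. if (y, y') \<in> R_set \<kappa> E then z $ (y, y')
      else ln (F0 $ y $ y') + g (\<kappa> y) (\<kappa> y'))"
    obtain F :: "real^('y \<times> 'y)" and f :: "real^'y" where F: "F \<in> lumpable_space \<kappa> E"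
      and pos: "\<And>e. e \<in> E \<Longrightarrow> F $ e > 0" and f: "\<And>x. f $ inv \<kappa> x = 0"
      and HF: "\<And>y y'. (y, y') \<in> E \<Longrightarrow> H $ y $ y' = ln (F $ (y, y')) + f $ y' - f $ y"
      by (rule log_image_attains[OF assms, where H=H and g=g]) (auto simp: H_def)
    define w where "w = z - \<Phi> (F, f, 0)"
    have "w $ e = 0" if e: "e \<in> J" for e
    proof -
      have "H $ fst e $ snd e = z $ e"
      proof (cases "e \<in> R_set \<kappa> E")
        case False
        then obtain u where u: "u \<in> U_set \<kappa> E" "e = r u" using e by (auto simp: J_def)
        then show ?thesis using r[OF u(1)] by (simp add: H_def g_def)
      qed (simp add: H_def)
      moreover have "e \<in> E" using e J by blast
      ultimately show ?thesis using HF[of "fst e" "snd e"] by (simp add: w_def \<Phi>_def)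
    qed
    then have "w \<in> ws" by (simp add: ws_def)
    moreover have "f \<in> fs" using f by (auto simp: fs_def)
    ultimately have "(F, f, w) \<in> S" using F pos by (simp add: S_def)
    moreover have "\<Phi> (F, f, w) = z" by (simp add: w_def \<Phi>_def vec_eq_iff)
    ultimately show ?thesis by force
  qed
  then have "\<Phi> ` S = UNIV" by blast
  ultimately show False by simp
qed

theorem corollary4p4:
  fixes E :: "('y::finite \<times> 'y) set" and \<kappa> :: "'y \<Rightarrow> 'x::finite"
  assumes "E \<noteq> {}" and "strongly_connected E" and "surj \<kappa>"
    and "1 < CARD('x)" and "CARD('x) < CARD('y)"
    and "lumpable \<kappa> E \<noteq> {}"
    and "(\<Sum>(x, x') \<in> lumped_edges \<kappa> E. int (card (fibre \<kappa> x)))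
         > (int (card (lumped_edges \<kappa> E)) - int (card (U_set \<kappa> E)))
           + (int CARD('y) - int CARD('x))
           + (int (card E) - int (card (R_set \<kappa> E)))"
  shows "\<not> e_family E (lumpable \<kappa> E)"
proof
  assume "e_family E (lumpable \<kappa> E)"
  then obtain K T where T: "log_affine E (lumpable \<kappa> E) K T"
    by (rule e_family_imp_log_affine)
  obtain F0 where F0: "F0 \<in> positive_lumpable \<kappa> E"
    using assms(6) by (auto simp: lumpable_eq)
  have "card (R_set \<kappa> E) + card (U_set \<kappa> E)
      \<le> dim (lumpable_space \<kappa> E) + (CARD('y) - CARD('x))"
    by (rule log_affine_dimension_bound[OF assms(1-3) T F0])
  then show False
    using dim_lumpable_space_le[OF assms(3) F0] assms(5,7) by linarith
qed

end
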